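(* Let $p>1$ be an integer and let $\Sigma=(\sigma^1,\dots,\sigma^p)\in(0,\infty)^p$ be fixed. The mixture model generated by the family $\mathfrak{L}_\Sigma=\{L_\Sigma(\,\cdot\,;\mu):(\mu,\Sigma)\in\Theta_\Sigma\}$ of $p$-dimensional logistic distribution functions with fixed scale $\Sigma$, with parameter set $\Theta_\Sigma=\mathbb{R}^p\times\{\Sigma\}$ and mixing distributions in the set $\mathfrak{R}_\Sigma$ of probability distributions on $\Theta_\Sigma$ with finite support, is identifiable. That is, for all $G_1,G_2\in\mathfrak{R}_\Sigma$, $$H(x,G_1)=H(x,G_2)\ \text{ for all } x\in\mathbb{R}^p\quad\Longleftrightarrow\quad G_1=G_2 .$$
   Context: For $\mu=(\mu^1,\dots,\mu^p)\in\mathbb{R}^p$ and $\Sigma=(\sigma^1,\dots,\sigma^p)\in(0,\infty)^p$ (superscripts are coordinate indices, not powers), the $p$-dimensional logistic cumulative distribution function with center $\mu$ and scale $\Sigma$ is $$L_\Sigma(x;\mu)=\Bigl[1+\sum_{k=1}^p\exp\bigl(-(x_k-\mu^k)/\sigma^k\bigr)\Bigr]^{-1},\qquad x=(x_1,\dots,x_p)\in\mathbb{R}^p.$$ For a probability distribution $G$ on $\Theta_\Sigma=\mathbb{R}^p\times\{\Sigma\}$ (identified with $\mathbb{R}^p$) with finite support, the $G$-mixture of $\mathfrak{L}_\Sigma$ is $$H(x,G)=\int_{\Theta_\Sigma}L_\Sigma(x;\mu)\,dG(\mu),$$ i.e. $H(x,G)=\sum_{i=1}^s\pi_i L_\Sigma(x;\mu_i)$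 if $G$ has distinct atoms $\mu_i$ with masses $\pi_i>0$, $\sum_{i=1}^s\pi_i=1$. *)

theory Defs
  imports "HOL-Probability.Probability"
begin

definition logistic_cdf :: "real ^ 'p::finite \<Rightarrow> real ^ 'p \<Rightarrow> real ^ 'p \<Rightarrow> real" where
  "logistic_cdf \<Sigma> x \<mu> = inverse (1 + (\<Sum>k\<in>UNIV. exp (- ((x $ k - \<mu> $ k) / \<Sigma> $ k))))"

definition param_space :: "real ^ 'p::finite \<Rightarrow> ((real ^ 'p) \<times> (real ^ 'p)) set" where
  "param_space \<Sigma> = UNIV \<times> {\<Sigma>}"

(* A finitely supported probability distribution is purely atomic and is determined by its
   atoms and their masses, so it is represented by a pmf; set_pmf G is its set of atoms. *)
definition finite_mixing_dists ::
    "real ^ 'p::finite \<Rightarrow> ((real ^ 'p) \<times> (real ^ 'p)) pmf set" where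
  "finite_mixing_dists \<Sigma> = {G. finite (set_pmf G) \<and> set_pmf G \<subseteq> param_space \<Sigma>}"

definition logistic_mixture ::
    "real ^ 'p::finite \<Rightarrow> ((real ^ 'p) \<times> (real ^ 'p)) pmf \<Rightarrow> real" where
  "logistic_mixture x G = measure_pmf.expectation G (\<lambda>(\<mu>, \<sigma>). logistic_cdf \<sigma> x \<mu>)"

lemma logistic_mixture_eq_sum:
  assumes "G \<in> finite_mixing_dists \<Sigma>"
  shows "logistic_mixture x G = (\<Sum>\<theta>\<in>set_pmf G. pmf G \<theta> * logistic_cdf \<Sigma> x (fst \<theta>))"
proof -
  have fin: "finite (set_pmf G)" and sub: "set_pmf G \<subseteq> UNIV \<times> {\<Sigma>}"
    using assms by (auto simp: finite_mixing_dists_def param_space_def)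
  have "logistic_mixture x G =
      (\<Sum>\<theta>\<in>set_pmf G. pmf G \<theta> * (case \<theta> of (\<mu>, \<sigma>) \<Rightarrow> logistic_cdf \<sigma> x \<mu>))"
    unfolding logistic_mixture_def
    by (subst integral_measure_pmf[OF fin]) auto
  also have "\<dots> = (\<Sum>\<theta>\<in>set_pmf G. pmf G \<theta> * logistic_cdf \<Sigma> x (fst \<theta>))"
    using sub by (intro sum.cong) auto
  finally show ?thesis .
qed

end

theory Submission
  imports Defs "HOL-Computational_Algebra.Polynomial"
begin

text \<open>
  In the coordinates \<open>y\<^sub>k = exp (- x\<^sub>k / \<sigma>\<^sub>k) > 0\<close> a logistic distribution function becomes
  \<open>1 / (1 + a \<bullet> y)\<close>, where \<open>a\<^sub>k = exp (\<mu>\<^sub>k / \<sigma>\<^sub>k)\<close> determines \<open>\<mu>\<close>. Finitely many distinct vectors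
  \<open>a\<close> have distinct inner products with a suitable positive direction \<open>y\<close>, and along the ray
  \<open>t y\<close> the functions \<open>1 / (1 + t (a \<bullet> y))\<close> have distinct poles, so they are linearly independent.
\<close>

text \<open>Clearing denominators turns the combination into a polynomial \<open>P\<close> that
  vanishes at every \<open>t > 0\<close>. So \<open>P\<close> is zero, and its value at the pole of
  the \<open>j\<close>-th fraction isolates \<open>c j\<close>.\<close>

lemma simple_fractions_independent:
  fixes b c :: "'a \<Rightarrow> real"
  assumes fin: "finite I" and inj: "inj_on b I" and pos: "\<And>i. i \<in> I \<Longrightarrow> b i > 0"
    and zero: "\<And>t. t > 0 \<Longrightarrow> (\<Sum>i\<in>I. c i / (1 + t * b i)) = 0"
    and j: "j \<in> I"
  shows "c j = 0"
proof -
  define P where "P = (\<Sum>i\<in>I. smult (c i) (\<Prod>k\<in>I - {i}. [:1, b k:]))"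
  have poly_P: "poly P t = (\<Sum>i\<in>I. c i * (\<Prod>k\<in>I - {i}. 1 + t * b k))" for t
    by (simp add: P_def poly_sum poly_prod)
  have "poly P t = 0" if "t > 0" for t
  proof -
    have nz: "1 + t * b i \<noteq> 0" if "i \<in> I" for i
      using mult_pos_pos[OF \<open>t > 0\<close> pos[OF that]] by linarith
    \<comment> \<open>The full product is the common denominator; dividing it by its
      \<open>i\<close>-th factor leaves the product over \<open>I - {i}\<close>.\<close>
    have "poly P t = (\<Sum>i\<in>I. (\<Prod>k\<in>I. 1 + t * b k) * (c i / (1 + t * b i)))"
      unfolding poly_P using nz by (intro sum.cong refl) (simp add: prod.remove[OF fin])
    also have "\<dots> = 0"
      unfolding sum_distrib_left[symmetric] zero[OF that] by simp
    finally show ?thesis .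
  qed
  then have "infinite {t. poly P t = 0}"
    using infinite_super[of "{0<..}" "{t. poly P t = 0}"] infinite_Ioi[of "0::real"] by auto
  then have "P = 0"
    using poly_roots_finite by blast
  then have "0 = poly P (- (1 / b j))" by simp
  also have "\<dots> = (\<Sum>i\<in>I. if i = j then c j * (\<Prod>k\<in>I - {j}. 1 + - (1 / b j) * b k) else 0)"
    unfolding poly_P
  proof (intro sum.cong refl)
    fix i assume "i \<in> I"
    \<comment> \<open>For \<open>i \<noteq> j\<close> the product still contains the factor for
      \<open>j\<close>, which vanishes at \<open>- (1 / b j)\<close>.\<close>
    have "(\<Prod>k\<in>I - {i}. 1 + - (1 / b j) * b k) = 0" if "i \<noteq> j"
      using fin j that pos[OF j] by (intro prod_zero) (auto intro!: bexI[of _ j])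
    then show "c i * (\<Prod>k\<in>I - {i}. 1 + - (1 / b j) * b k) =
        (if i = j then c j * (\<Prod>k\<in>I - {j}. 1 + - (1 / b j) * b k) else 0)"
      by auto
  qed
  also have "\<dots> = c j * (\<Prod>k\<in>I - {j}. 1 + - (1 / b j) * b k)"
    using fin j by simp
  finally have "c j = 0 \<or> (\<exists>k\<in>I - {j}. 1 + - (1 / b j) * b k = 0)"
    using fin by auto
  moreover have "1 + - (1 / b j) * b k \<noteq> 0" if "k \<in> I - {j}" for k
    using that inj j pos[OF j] by (auto simp: inj_on_def field_simps)
  ultimately show ?thesis by blast
qed

text \<open>Each pair of distinct vectors rules out only the directions in one hyperplane. Finitely
  many hyperplanes form a null set, so they cannot cover the open unit box, whose points have
  positive coordinates.\<close>

lemma exists_positive_separating_direction: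
  fixes A :: "(real ^ 'n::finite) set"
  assumes "finite A"
  obtains y where "\<And>k. y $ k > 0" and "inj_on (\<lambda>a. a \<bullet> y) A"
proof -
  let ?H = "\<Union>(a, b)\<in>{p \<in> A \<times> A. fst p \<noteq> snd p}. {y. (a - b) \<bullet> y = 0}"
  have "negligible ?H"
    using assms by (intro negligible_Union) (auto intro!: negligible_hyperplane)
  moreover have "\<not> negligible (box 0 (1 :: real ^ 'n))"
    by (intro open_not_negligible) (auto simp: interval_ne_empty_cart)
  ultimately obtain y where "y \<in> box 0 1" and "y \<notin> ?H"
    using negligible_subset by blast
  then have "\<And>k. y $ k > 0" and "inj_on (\<lambda>a. a \<bullet> y) A"
    by (auto simp: mem_box_cart inj_on_def inner_diff_left)
  then show ?thesis by (rule that)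
qed

lemma logistic_cdf_independent:
  fixes \<Sigma> :: "real ^ 'p::finite"
  assumes \<Sigma>: "\<And>k. \<Sigma> $ k > 0" and fin: "finite M"
    and zero: "\<And>x. (\<Sum>\<mu>\<in>M. c \<mu> * logistic_cdf \<Sigma> x \<mu>) = 0"
    and "\<nu> \<in> M"
  shows "c \<nu> = 0"
proof -
  define a :: "real ^ 'p \<Rightarrow> real ^ 'p" where "a \<mu> = (\<chi> k. exp (\<mu> $ k / \<Sigma> $ k))" for \<mu>
  have "inj_on a M"
    using \<Sigma> by (auto simp: inj_on_def a_def vec_eq_iff less_imp_neq[THEN not_sym])
  obtain y where y: "\<And>k. y $ k > 0" and sep: "inj_on (\<lambda>v. v \<bullet> y) (a ` M)"
    using exists_positive_separating_direction[OF finite_imageI[OF fin]] by metis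
  have "inj_on (\<lambda>\<mu>. a \<mu> \<bullet> y) M"
    using comp_inj_on[OF \<open>inj_on a M\<close> sep] by (simp add: o_def)
  moreover have "a \<mu> \<bullet> y > 0" for \<mu>
    using y by (auto simp: inner_vec_def a_def intro!: sum_pos)
  moreover have "(\<Sum>\<mu>\<in>M. c \<mu> / (1 + t * (a \<mu> \<bullet> y))) = 0" if "t > 0" for t
  proof -
    \<comment> \<open>Chosen so that \<open>exp (- x $ k / \<Sigma> $ k) = t * y $ k\<close>, which
      puts the transformed point on the ray through \<open>y\<close>.\<close>
    define x :: "real ^ 'p" where "x = (\<chi> k. - \<Sigma> $ k * ln (t * y $ k))"
    have "exp (- ((x $ k - \<mu> $ k) / \<Sigma> $ k)) = t * (a \<mu> $ k * y $ k)" for \<mu> k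
    proof -
      have "- ((x $ k - \<mu> $ k) / \<Sigma> $ k) = ln (t * y $ k) + \<mu> $ k / \<Sigma> $ k"
        using \<Sigma>[of k] by (simp add: x_def field_simps)
      then show ?thesis
        using that y[of k] by (simp add: exp_add a_def)
    qed
    then have "logistic_cdf \<Sigma> x \<mu> = 1 / (1 + t * (a \<mu> \<bullet> y))" for \<mu>
      by (simp add: logistic_cdf_def inner_vec_def sum_distrib_left inverse_eq_divide)
    then show ?thesis
      using zero[of x] by simp
  qed
  ultimately show ?thesis
    using simple_fractions_independent[OF fin] \<open>\<nu> \<in> M\<close> by blast
qed

text \<open>Lets two mixtures be summed over one common set of centers and then subtracted; centers
  outside the support carry mass zero.\<close>

lemma logistic_mixture_eq_sum_superset:
  assumes G: "G \<in> finite_mixing_dists \<Sigma>" and "finite M" and "fst ` set_pmf G \<subseteq> M"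
  shows "logistic_mixture x G = (\<Sum>\<mu>\<in>M. pmf G (\<mu>, \<Sigma>) * logistic_cdf \<Sigma> x \<mu>)"
proof -
  have "set_pmf G \<subseteq> (\<lambda>\<mu>. (\<mu>, \<Sigma>)) ` M"
    using assms by (force simp: finite_mixing_dists_def param_space_def)
  then have "logistic_mixture x G =
      (\<Sum>\<theta>\<in>(\<lambda>\<mu>. (\<mu>, \<Sigma>)) ` M. pmf G \<theta> * logistic_cdf \<Sigma> x (fst \<theta>))"
    unfolding logistic_mixture_eq_sum[OF G] using \<open>finite M\<close>
    by (intro sum.mono_neutral_left) (auto simp: set_pmf_iff)
  then show ?thesis
    by (simp add: sum.reindex inj_on_def)
qed

theorem theorem2:
  fixes \<Sigma> :: "real ^ 'p::finite"
  assumes "CARD('p) > 1"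
    and "\<forall>k. \<Sigma> $ k > 0"
  shows "\<forall>G1 \<in> finite_mixing_dists \<Sigma>. \<forall>G2 \<in> finite_mixing_dists \<Sigma>.
    (\<forall>x. logistic_mixture x G1 = logistic_mixture x G2) \<longleftrightarrow> G1 = G2"
proof (intro ballI iffI)
  fix G1 G2
  assume G: "G1 \<in> finite_mixing_dists \<Sigma>" "G2 \<in> finite_mixing_dists \<Sigma>"
    and eq: "\<forall>x. logistic_mixture x G1 = logistic_mixture x G2"
  define M where "M = fst ` (set_pmf G1 \<union> set_pmf G2)"
  have fin: "finite M"
    using G by (simp add: M_def finite_mixing_dists_def)
  have "(\<Sum>\<mu>\<in>M. (pmf G1 (\<mu>, \<Sigma>) - pmf G2 (\<mu>, \<Sigma>)) * logistic_cdf \<Sigma> x \<mu>) = 0" for x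
    using eq G[THEN logistic_mixture_eq_sum_superset, OF fin]
    by (simp add: M_def image_Un left_diff_distrib sum_subtractf)
  then have eq_M: "pmf G1 (\<mu>, \<Sigma>) = pmf G2 (\<mu>, \<Sigma>)" if "\<mu> \<in> M" for \<mu>
    using logistic_cdf_independent[of \<Sigma> M "\<lambda>\<mu>. pmf G1 (\<mu>, \<Sigma>) - pmf G2 (\<mu>, \<Sigma>)"] fin that assms(2)
    by simp
  show "G1 = G2"
  proof (rule pmf_eqI)
    fix \<theta>
    show "pmf G1 \<theta> = pmf G2 \<theta>"
    \<comment> \<open>An atom of either distribution has scale \<open>\<Sigma>\<close> and center in
      \<open>M\<close>, so \<open>eq_M\<close> applies; elsewhere both masses are zero.\<close>
    proof (cases "\<theta> \<in> set_pmf G1 \<union> set_pmf G2")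
      case True
      then have "fst \<theta> \<in> M" and "\<theta> = (fst \<theta>, \<Sigma>)"
        using G by (auto simp: M_def finite_mixing_dists_def param_space_def)
      then show ?thesis
        using eq_M by metis
    qed (simp add: set_pmf_iff)
  qed
qed simp

end
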